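(* For every $\varepsilon>0$ and real $a\le0\le b$, there exists a randomized algorithm $M:[a,b]^*\to\mathbb{R}$ that is $(\varepsilon,0)$-differentially private with respect to addition, removal, or replacement of an element, such that the following holds. Let $P$ be a distribution supported on $[a,b]$ with $\mathbb{E}_{X\leftarrow P}[(X-\mu(P))^2]\le1$, where $\mu(P):=\mathbb{E}_{X\leftarrow P}[X]$. Then for all integers $n\ge1$, $$\mathbb{E}_{X\leftarrow P^n,M}[M(X)]=\mu(P),$$ $$\mathbb{E}_{X\leftarrow P^n,M}\left[(M(X)-\mu(P))^2\right]\le\frac1n+\frac{9}{\varepsilon^2}(b-a)^2\max\left\{\exp(-\varepsilon(n-1)/6),\ \frac1{n^2}\right\}.$$
   Context: $[a,b]^*=\bigcup_{n=0}^\infty[a,b]^n$ is the set of datasets of arbitrary finite size. $M$ is $(\varepsilon,0)$-differentially private with respect to addition, removal, or replacement of an element if $\Pr[M(x)\in S]\le e^\varepsilon\Pr[M(x')\in S]$ for all measurable $S\subseteq\mathbb{R}$ and all $x,x'\in[a,b]^*$ such that $x'$ is obtained from $x$ by adding, removing or replacing one element. $X\leftarrow P^n$ means $n$ i.i.d. samples from $P$; expectations are over $X$ and the independent internal randomness of $M$. *)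

theory Defs
  imports "HOL-Probability.Probability"
begin

inductive neighbouring :: "'a list \<Rightarrow> 'a list \<Rightarrow> bool" where
  add: "neighbouring (xs @ ys) (xs @ [z] @ ys)"
| remove: "neighbouring (xs @ [z] @ ys) (xs @ ys)"
| replace: "neighbouring (xs @ [y] @ ys) (xs @ [z] @ ys)"

text \<open>
  A dataset in \<open>[a,b]\<^sup>*\<close> is an element of \<^term>\<open>lists {a..b}\<close>. A randomized algorithm sends every
  dataset to the law of its output. It is required to be a Markov kernel on \<open>[a,b]\<^sup>n\<close> for every \<open>n\<close>
  (including \<open>n = 0\<close>), so that it can be run on random datasets; the coordinate functions in
  the product space \<open>[a,b]\<^sup>n\<close> are turned into lists by \<^term>\<open>\<lambda>x. map x [0..<n]\<close>. The values
  outside \<^term>\<open>lists {a..b}\<close> are irrelevant.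
\<close>

definition randomized_algorithm :: "real \<Rightarrow> real \<Rightarrow> (real list \<Rightarrow> real measure) \<Rightarrow> bool" where
  "randomized_algorithm a b M \<longleftrightarrow>
     (\<forall>n. (\<lambda>x. M (map x [0..<n]))
            \<in> (\<Pi>\<^sub>M i\<in>{..<n}. restrict_space borel {a..b}) \<rightarrow>\<^sub>M prob_algebra borel)"

definition differentially_private ::
    "real \<Rightarrow> real \<Rightarrow> real \<Rightarrow> (real list \<Rightarrow> real measure) \<Rightarrow> bool" where
  "differentially_private \<epsilon> a b M \<longleftrightarrow>
     (\<forall>x\<in>lists {a..b}. \<forall>x'\<in>lists {a..b}. neighbouring x x' \<longrightarrow>
        (\<forall>S\<in>sets borel. measure (M x) S \<le> exp \<epsilon> * measure (M x') S))"

definition distribution_supported_on :: "real measure \<Rightarrow> real set \<Rightarrow> bool" where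
  "distribution_supported_on P A \<longleftrightarrow>
     prob_space P \<and> sets P = sets borel \<and> measure P A = 1"

definition mean :: "real measure \<Rightarrow> real" where
  "mean P = (\<integral>x. x \<partial>P)"

text \<open>
  The law of \<open>M(X)\<close> when \<open>X\<close> consists of \<open>n\<close> independent samples from \<open>P\<close> and \<open>M\<close> uses
  independent internal randomness. The samples are drawn from \<open>P\<close> restricted to its
  support \<open>[a,b]\<close>, because \<open>M\<close> is a kernel only there.
\<close>

definition output_law ::
    "real \<Rightarrow> real \<Rightarrow> (real list \<Rightarrow> real measure) \<Rightarrow> real measure \<Rightarrow> nat \<Rightarrow> real measure" where
  "output_law a b M P n =
     (\<Pi>\<^sub>M i\<in>{..<n}. restrict_space P {a..b}) \<bind> (\<lambda>x. M (map x [0..<n]))"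

end

theory Submission
  imports Defs "HOL-Real_Asymp.Real_Asymp"
begin

text \<open>
  The mechanism releases the empirical mean plus centred noise whose scale depends on the size
  \<open>n\<close> of the dataset. The mean of the empty dataset is taken to be \<open>0\<close>; as \<open>0\<close> lies in
  \<open>[a,b]\<close>, changing one element of a dataset of size \<open>n\<close> moves the mean by at most
  \<open>(b - a) / max 1 n\<close> (lemma \<open>average_sensitivity\<close>). Noise of scale proportional to \<open>1/n\<close> hides
  this move, but for small \<open>n\<close> the scale itself would jump too much between neighbouring datasets
  and reveal \<open>n\<close>. The scale is therefore taken proportional to
  \<open>max (exp (- t (n - 1))) (1 / n)\<close>, which dominates \<open>1 / max 1 n\<close> and changes by a factor at
  most \<open>exp t\<close> when \<open>n\<close> changes by one (\<open>smooth_scale_lower\<close>, \<open>smooth_scale_neighbouring\<close>). The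
  second property survives the passage between the two branches of the maximum because \<open>1/n\<close> takes
  over only once \<open>t \<ge> ln n / (n - 1) \<ge> 1/n\<close>.

  The noise must tolerate both a shift and a change of scale at a bounded cost in the
  log-density. This excludes exponential tails, for which a change of scale has unbounded cost, and
  suggests a polynomial density with a finite second moment. The choice
  \<open>2 / (\<pi> (1 + z\<^sup>2)\<^sup>2)\<close> has mean \<open>0\<close> and variance \<open>1\<close>; at scale \<open>s\<close> a shift by \<open>v\<close> costs
  \<open>2 |v| / s\<close> (\<open>noise_density_shift\<close>) and a change of scale by a factor \<open>R\<close> costs
  \<open>3 ln R\<close> (\<open>noise_density_rescale\<close>). With \<open>t = \<epsilon>/12\<close> and
  \<open>s = 3 (b - a) / \<epsilon> \<cdot> max (exp (- t (n - 1))) (1 / n)\<close> the costs are at most \<open>2\<epsilon>/3\<close> and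
  \<open>\<epsilon>/4\<close>, which is below \<open>\<epsilon>\<close>.

  Since the noise is centred and independent of the data, the output is unbiased, and its variance
  is that of the empirical mean, at most \<open>1/n\<close>, plus \<open>s\<^sup>2\<close>
  (\<open>additive_noise_moments\<close>, \<open>iid_sum_square\<close>). Squaring \<open>s\<close> gives exactly the second term of
  the bound.
\<close>

section \<open>A polynomially decaying noise distribution\<close>

text \<open>
  This is the density at scale \<open>s\<close> of a Student distribution with three degrees of freedom,
  normalised so that its standard deviation is \<open>s\<close>. The form in which \<open>s\<close> multiplies out the inner
  fraction makes the dependence on the scale a rational function of \<open>s\<close>.
\<close>
definition noise_density :: "real \<Rightarrow> real \<Rightarrow> real" where
  "noise_density s y = 2 / pi * s ^ 3 / (s\<^sup>2 + y\<^sup>2)\<^sup>2"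

definition noise :: "real measure" where
  "noise = density lborel (\<lambda>z. ennreal (noise_density 1 z))"

lemma noise_density_nonneg: "s > 0 \<Longrightarrow> noise_density s y \<ge> 0"
  by (simp add: noise_density_def)

lemma borel_measurable_noise_density [measurable]: "noise_density s \<in> borel_measurable borel"
  unfolding noise_density_def by measurable

text \<open>
  The antiderivative is \<open>arctan x + k x / (1 + x\<^sup>2)\<close>, whose rational part vanishes at both ends.
  The case \<open>k = 1\<close> normalises the noise and the case \<open>k = -1\<close> gives its variance.
\<close>
lemma has_bochner_integral_quadratic_over_square:
  fixes k :: real
  assumes "\<bar>k\<bar> \<le> 1"
  shows "has_bochner_integral lborel (\<lambda>x. (1 + k + (1 - k) * x\<^sup>2) / (1 + x\<^sup>2)\<^sup>2) pi"
proof -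
  let ?f = "\<lambda>x::real. (1 + k + (1 - k) * x\<^sup>2) / (1 + x\<^sup>2)\<^sup>2"
  let ?F = "\<lambda>x::real. arctan x + k * (x / (1 + x\<^sup>2))"
  have pos: "1 + x\<^sup>2 > 0" for x :: real
    by (simp add: add_pos_nonneg)
  then have nz: "1 + x\<^sup>2 \<noteq> 0" for x :: real
    by (metis less_irrefl)
  have DF: "DERIV ?F x :> ?f x" for x
  proof -
    have "DERIV ?F x :> inverse (1 + x\<^sup>2) + k * ((1 * (1 + x\<^sup>2) - x * (2 * x)) / (1 + x\<^sup>2)\<^sup>2)"
      by (rule derivative_eq_intros refl nz | simp)+ (simp add: nz power2_eq_square algebra_simps)
    also have "inverse (1 + x\<^sup>2) + k * ((1 * (1 + x\<^sup>2) - x * (2 * x)) / (1 + x\<^sup>2)\<^sup>2) = ?f x"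
    proof -
      have "inverse (1 + x\<^sup>2) = (1 + x\<^sup>2) / (1 + x\<^sup>2)\<^sup>2"
        using nz[of x] by (simp add: power2_eq_square[of "1 + x\<^sup>2"] inverse_eq_divide)
      then show ?thesis
        by (simp add: power2_eq_square[of x] flip: add_divide_distrib) (simp add: algebra_simps power2_eq_square)
    qed
    finally show ?thesis .
  qed
  have cont: "isCont ?f x" for x
    using nz by (intro continuous_intros) auto
  have nn: "?f x \<ge> 0" for x
  proof -
    have "0 \<le> 1 + k" "0 \<le> 1 - k" using assms by auto
    then show ?thesis by simp
  qed
  have frac_top: "((\<lambda>x::real. x / (1 + x\<^sup>2)) \<longlongrightarrow> 0) at_top"
    and frac_bot: "((\<lambda>x::real. x / (1 + x\<^sup>2)) \<longlongrightarrow> 0) at_bot"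
    by real_asymp+
  have top: "(?F \<longlongrightarrow> pi / 2 + k * 0) at_top"
    by (intro tendsto_intros tendsto_arctan_at_top frac_top)
  have bot: "(?F \<longlongrightarrow> - (pi / 2) + k * 0) at_bot"
    by (intro tendsto_intros tendsto_arctan_at_bot frac_bot)
  have A: "((?F \<circ> real_of_ereal) \<longlongrightarrow> - (pi / 2)) (at_right (-\<infinity>))"
    and B: "((?F \<circ> real_of_ereal) \<longlongrightarrow> pi / 2) (at_left \<infinity>)"
    using top bot by (simp_all add: ereal_tendsto_simps)
  have "set_integrable lborel (einterval (-\<infinity>) \<infinity>) ?f"
    "(LBINT x=-\<infinity>..\<infinity>. ?f x) = pi / 2 - - (pi / 2)"
    by (rule interval_integral_FTC_nonneg[where F = ?F]; (rule DF cont A B | use nn in simp))+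
  then show ?thesis
    by (simp add: has_bochner_integral_iff set_integrable_def interval_lebesgue_integral_def
        set_lebesgue_integral_def)
qed

text \<open>
  The function \<open>u \<mapsto> ln (1 + u\<^sup>2)\<close> is 1-Lipschitz, because its derivative \<open>2u / (1 + u\<^sup>2)\<close> has
  absolute value at most \<open>1\<close>. In the proof this appears as a derivative that is minus a square.
\<close>
lemma one_plus_square_shift_nonneg:
  fixes x v :: real
  assumes "v \<ge> 0"
  shows "1 + (x + v)\<^sup>2 \<le> exp v * (1 + x\<^sup>2)"
proof -
  let ?g = "\<lambda>u. exp (- u) * (1 + (x + u)\<^sup>2)"
  have "?g v \<le> ?g 0"
  proof (rule DERIV_nonpos_imp_nonincreasing[OF assms])
    fix u
    have "DERIV ?g u :> - (exp (- u) * (1 - (x + u))\<^sup>2)"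
      by (auto intro!: derivative_eq_intros simp: power2_eq_square algebra_simps)
    then show "\<exists>y. DERIV ?g u :> y \<and> y \<le> 0"
      by fastforce
  qed
  then show ?thesis
    by (simp add: exp_minus field_simps)
qed

lemma one_plus_square_shift:
  fixes x v :: real
  shows "1 + (x + v)\<^sup>2 \<le> exp \<bar>v\<bar> * (1 + x\<^sup>2)"
proof (cases "v \<ge> 0")
  case True
  then show ?thesis using one_plus_square_shift_nonneg[of v x] by simp
next
  case False
  have "(- x + - v)\<^sup>2 = (x + v)\<^sup>2" by (simp add: power2_eq_square algebra_simps)
  then show ?thesis using False one_plus_square_shift_nonneg[of "- v" "- x"] by simp
qed

lemma noise_density_shift:
  assumes "s > 0"
  shows "noise_density s y \<le> exp (2 * \<bar>v\<bar> / s) * noise_density s (y + v)"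
proof -
  have "s\<^sup>2 + (y + v)\<^sup>2 = s\<^sup>2 * (1 + ((y / s) + v / s)\<^sup>2)"
    using assms by (simp add: field_simps)
  also have "\<dots> \<le> s\<^sup>2 * (exp \<bar>v / s\<bar> * (1 + (y / s)\<^sup>2))"
    by (intro mult_left_mono one_plus_square_shift) auto
  also have "\<dots> = exp (\<bar>v\<bar> / s) * (s\<^sup>2 + y\<^sup>2)"
    using assms by (simp add: field_simps)
  finally have "(s\<^sup>2 + (y + v)\<^sup>2)\<^sup>2 \<le> (exp (\<bar>v\<bar> / s) * (s\<^sup>2 + y\<^sup>2))\<^sup>2"
    by (rule power_mono) simp
  also have "\<dots> = exp (2 * \<bar>v\<bar> / s) * (s\<^sup>2 + y\<^sup>2)\<^sup>2"
    by (simp add: power_mult_distrib flip: exp_double)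
  finally have le: "(s\<^sup>2 + (y + v)\<^sup>2)\<^sup>2 \<le> exp (2 * \<bar>v\<bar> / s) * (s\<^sup>2 + y\<^sup>2)\<^sup>2" .
  have pos: "s\<^sup>2 + w\<^sup>2 > 0" for w
    using assms by (simp add: add_pos_nonneg)
  have "1 / (s\<^sup>2 + y\<^sup>2)\<^sup>2 \<le> exp (2 * \<bar>v\<bar> / s) / (s\<^sup>2 + (y + v)\<^sup>2)\<^sup>2"
    using le zero_less_power[OF pos[of y], of 2] zero_less_power[OF pos[of "y + v"], of 2]
    by (simp add: pos_divide_le_eq pos_le_divide_eq)
  then have "2 / pi * s ^ 3 * (1 / (s\<^sup>2 + y\<^sup>2)\<^sup>2)
      \<le> 2 / pi * s ^ 3 * (exp (2 * \<bar>v\<bar> / s) / (s\<^sup>2 + (y + v)\<^sup>2)\<^sup>2)"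
    using assms by (intro mult_left_mono) auto
  then show ?thesis
    by (simp add: noise_density_def mult_ac)
qed

text \<open>
  As a function of \<open>ln s\<close>, the log-density has slope \<open>3 - 4 s\<^sup>2 / (s\<^sup>2 + y\<^sup>2)\<close>, which lies between
  \<open>-1\<close> and \<open>3\<close> uniformly in \<open>y\<close>. The two cases of the proof are the two signs of the change.
\<close>
lemma noise_density_rescale:
  assumes "s > 0" "s' > 0" "R \<ge> 1" "s \<le> R * s'" "s' \<le> R * s"
  shows "noise_density s y \<le> R ^ 3 * noise_density s' y"
proof -
  have pos: "s\<^sup>2 + y\<^sup>2 > 0" "s'\<^sup>2 + y\<^sup>2 > 0"
    using assms by (simp_all add: add_pos_nonneg)
  have "s ^ 3 * (s'\<^sup>2 + y\<^sup>2)\<^sup>2 \<le> R ^ 3 * s' ^ 3 * (s\<^sup>2 + y\<^sup>2)\<^sup>2"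
  proof (cases "s' \<le> s")
    case True
    have "s ^ 3 \<le> (R * s') ^ 3"
      using assms by (intro power_mono) auto
    moreover have "(s'\<^sup>2 + y\<^sup>2)\<^sup>2 \<le> (s\<^sup>2 + y\<^sup>2)\<^sup>2"
      using True assms by (intro power_mono) (simp_all add: power_mono)
    ultimately show ?thesis
      using assms mult_mono[of "s ^ 3" "(R * s') ^ 3" "(s'\<^sup>2 + y\<^sup>2)\<^sup>2" "(s\<^sup>2 + y\<^sup>2)\<^sup>2"]
      by (simp add: power_mult_distrib)
  next
    case False
    define \<rho> where "\<rho> = s' / s"
    have r: "1 \<le> \<rho>" "\<rho> \<le> R" and s': "s' = \<rho> * s"
      using assms False by (auto simp: \<rho>_def field_simps)
    have "1 \<le> \<rho>\<^sup>2" using r by (simp add: one_le_power)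
    then have "s'\<^sup>2 + y\<^sup>2 \<le> \<rho>\<^sup>2 * (s\<^sup>2 + y\<^sup>2)"
      using mult_right_mono[of 1 "\<rho>\<^sup>2" "y\<^sup>2"] by (simp add: s' power_mult_distrib distrib_left)
    then have "(s'\<^sup>2 + y\<^sup>2)\<^sup>2 \<le> (\<rho>\<^sup>2 * (s\<^sup>2 + y\<^sup>2))\<^sup>2"
      using pos by (intro power_mono) auto
    then have "s ^ 3 * (s'\<^sup>2 + y\<^sup>2)\<^sup>2 \<le> s ^ 3 * (\<rho>\<^sup>2 * (s\<^sup>2 + y\<^sup>2))\<^sup>2"
      using assms by (intro mult_left_mono) auto
    also have "\<dots> = \<rho> * (s' ^ 3 * (s\<^sup>2 + y\<^sup>2)\<^sup>2)"
      by (simp add: s' power2_eq_square power3_eq_cube)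
    also have "\<dots> \<le> R ^ 3 * (s' ^ 3 * (s\<^sup>2 + y\<^sup>2)\<^sup>2)"
    proof (intro mult_right_mono)
      show "\<rho> \<le> R ^ 3" using r(2) assms(3) self_le_power[of R 3] by simp
    qed (use assms in auto)
    finally show ?thesis by (simp add: mult.assoc)
  qed
  then have "s ^ 3 / (s\<^sup>2 + y\<^sup>2)\<^sup>2 \<le> R ^ 3 * s' ^ 3 / (s'\<^sup>2 + y\<^sup>2)\<^sup>2"
    using zero_less_power[OF pos(1), of 2] zero_less_power[OF pos(2), of 2]
    by (simp add: pos_divide_le_eq pos_le_divide_eq)
  then have "2 / pi * (s ^ 3 / (s\<^sup>2 + y\<^sup>2)\<^sup>2) \<le> 2 / pi * (R ^ 3 * s' ^ 3 / (s'\<^sup>2 + y\<^sup>2)\<^sup>2)"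
    by (intro mult_left_mono) auto
  then show ?thesis
    by (simp add: noise_density_def mult_ac)
qed

lemma sets_noise [measurable_cong, simp]: "sets noise = sets borel"
  by (simp add: noise_def)

lemma space_noise [simp]: "space noise = UNIV"
  by (simp add: noise_def)

lemma
  shows prob_space_noise: "prob_space noise"
    and noise_integrable_square: "integrable noise (\<lambda>z. z\<^sup>2)"
    and noise_variance: "(\<integral>z. z\<^sup>2 \<partial>noise) = 1"
    and noise_integrable: "integrable noise (\<lambda>z. z)"
    and noise_mean: "(\<integral>z. z \<partial>noise) = 0"
proof -
  have "has_bochner_integral lborel (noise_density 1) (1 / pi * pi)"
    using has_bochner_integral_mult_right[OF has_bochner_integral_quadratic_over_square[of 1], of "1 / pi"]
    by (simp add: noise_density_def [abs_def])
  then have "(\<integral>\<^sup>+z. ennreal (noise_density 1 z) \<partial>lborel) = 1"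
    by (subst nn_integral_eq_integral) (auto simp: has_bochner_integral_iff noise_density_nonneg)
  then show prob: "prob_space noise"
    by (intro prob_spaceI) (simp add: noise_def emeasure_density)
  have "has_bochner_integral lborel (\<lambda>z. noise_density 1 z * z\<^sup>2) (1 / pi * pi)"
    using has_bochner_integral_mult_right[OF has_bochner_integral_quadratic_over_square[of "-1"], of "1 / pi"]
    by (simp add: noise_density_def [abs_def])
  then show sq: "integrable noise (\<lambda>z. z\<^sup>2)" and "(\<integral>z. z\<^sup>2 \<partial>noise) = 1"
    by (simp_all add: noise_def integrable_density integral_density noise_density_nonneg
        has_bochner_integral_iff)
  interpret prob_space noise by (rule prob)
  show "integrable noise (\<lambda>z. z)"
    by (rule square_integrable_imp_integrable[OF _ sq]) simp
  \<comment> \<open>The integrand is odd, so the substitution \<open>z \<mapsto> -z\<close> changes the sign of the integral.\<close>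
  have "(\<integral>z. z \<partial>noise) = (\<integral>z. noise_density 1 z * z \<partial>lborel)"
    by (simp add: noise_def integral_density noise_density_nonneg)
  also have "\<dots> = - (\<integral>z. noise_density 1 z * z \<partial>lborel)"
    using lborel_integral_real_affine[of "-1" "\<lambda>z. noise_density 1 z * z" 0]
    by (simp add: noise_density_def)
  finally show "(\<integral>z. z \<partial>noise) = 0"
    by (simp add: noise_def integral_density noise_density_nonneg)
qed

lemma emeasure_affine_noise:
  assumes "s > 0" and [measurable]: "S \<in> sets borel"
  shows "emeasure (distr noise borel (\<lambda>z. m + s * z)) S
    = (\<integral>\<^sup>+y. ennreal (noise_density s (y - m)) * indicator S y \<partial>lborel)"
proof -
  have sc: "ennreal s * ennreal (noise_density s (s * z)) = ennreal (noise_density 1 z)" for z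
  proof -
    have "s * noise_density s (s * z) = noise_density 1 z"
    proof -
      have "(s\<^sup>2 + (s * z)\<^sup>2)\<^sup>2 = (s\<^sup>2 * (1 + z\<^sup>2))\<^sup>2"
        by (simp add: power_mult_distrib distrib_left)
      also have "\<dots> = s * s ^ 3 * (1 + z\<^sup>2)\<^sup>2"
        by (simp add: power2_eq_square power3_eq_cube)
      finally show ?thesis using assms(1)
        by (simp add: noise_density_def)
    qed
    then show ?thesis using assms(1) by (simp flip: ennreal_mult')
  qed
  have "(\<integral>\<^sup>+y. ennreal (noise_density s (y - m)) * indicator S y \<partial>lborel)
    = \<bar>s\<bar> * (\<integral>\<^sup>+z. ennreal (noise_density s (m + s * z - m)) * indicator S (m + s * z) \<partial>lborel)"
    by (rule nn_integral_real_affine) (use assms in auto)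
  also have "\<dots> = (\<integral>\<^sup>+z. ennreal s * (ennreal (noise_density s (s * z)) * indicator S (m + s * z)) \<partial>lborel)"
    using assms(1) by (simp add: nn_integral_cmult)
  also have "\<dots> = (\<integral>\<^sup>+z. ennreal (noise_density 1 z) * indicator ((\<lambda>z. m + s * z) -` S) z \<partial>lborel)"
    by (intro nn_integral_cong) (simp add: sc indicator_def flip: mult.assoc)
  also have "\<dots> = emeasure noise ((\<lambda>z. m + s * z) -` S)"
    unfolding noise_def by (subst emeasure_density) (auto intro!: measurable_sets_borel[of _ borel])
  also have "\<dots> = emeasure (distr noise borel (\<lambda>z. m + s * z)) S"
    by (subst emeasure_distr) (auto simp: noise_def)
  finally show ?thesis ..
qed

text \<open>
  The density at \<open>(m, s)\<close> is compared with the one at \<open>(m', s')\<close> by first moving the centre at the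
  scale \<open>s\<close> and then changing the scale around \<open>m'\<close>, so only \<open>s\<close> occurs in the cost of the shift.
\<close>
lemma affine_noise_private:
  assumes "s > 0" "s' > 0" "R \<ge> 1" "s \<le> R * s'" "s' \<le> R * s"
    and budget: "exp (2 * \<bar>m - m'\<bar> / s) * R ^ 3 \<le> exp \<epsilon>"
    and [measurable]: "S \<in> sets borel"
  shows "measure (distr noise borel (\<lambda>z. m + s * z)) S
    \<le> exp \<epsilon> * measure (distr noise borel (\<lambda>z. m' + s' * z)) S"
proof -
  have pt: "noise_density s (y - m) \<le> exp \<epsilon> * noise_density s' (y - m')" for y
  proof -
    have "noise_density s (y - m) \<le> exp (2 * \<bar>m - m'\<bar> / s) * noise_density s (y - m')"
      using noise_density_shift[OF assms(1), of "y - m" "m - m'"] by simp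
    also have "\<dots> \<le> exp (2 * \<bar>m - m'\<bar> / s) * (R ^ 3 * noise_density s' (y - m'))"
      by (intro mult_left_mono noise_density_rescale assms) auto
    also have "\<dots> \<le> exp \<epsilon> * noise_density s' (y - m')"
      using mult_right_mono[OF budget noise_density_nonneg[OF assms(2)]] by (simp add: mult.assoc)
    finally show ?thesis .
  qed
  interpret N: prob_space noise by (rule prob_space_noise)
  interpret A: prob_space "distr noise borel (\<lambda>z. m + s * z)"
    by (rule N.prob_space_distr) simp
  interpret B: prob_space "distr noise borel (\<lambda>z. m' + s' * z)"
    by (rule N.prob_space_distr) simp
  have "emeasure (distr noise borel (\<lambda>z. m + s * z)) S
    \<le> (\<integral>\<^sup>+y. ennreal (exp \<epsilon>) * (ennreal (noise_density s' (y - m')) * indicator S y) \<partial>lborel)"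
    unfolding emeasure_affine_noise[OF assms(1,7)]
    by (intro nn_integral_mono)
       (auto simp: indicator_def pt ennreal_leI simp flip: ennreal_mult')
  also have "\<dots> = ennreal (exp \<epsilon>) * emeasure (distr noise borel (\<lambda>z. m' + s' * z)) S"
    by (simp add: emeasure_affine_noise[OF assms(2,7)] nn_integral_cmult)
  finally show ?thesis
    by (simp add: A.emeasure_eq_measure B.emeasure_eq_measure flip: ennreal_mult')
qed


section \<open>Moments of the noisy mean\<close>

text \<open>
  Drawing fresh randomness after the data is the same as drawing both independently at the start;
  this brings Fubini's theorem to bear on the output of a randomized algorithm.
\<close>
lemma bind_distr_eq_distr_pair:
  assumes Q: "prob_space Q" and T: "prob_space T"
    and [measurable]: "(\<lambda>(x, z). f x z) \<in> Q \<Otimes>\<^sub>M T \<rightarrow>\<^sub>M N"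
  shows "Q \<bind> (\<lambda>x. distr T N (f x)) = distr (Q \<Otimes>\<^sub>M T) N (\<lambda>(x, z). f x z)"
proof -
  interpret Q: prob_space Q by (rule Q)
  interpret T: prob_space T by (rule T)
  have K: "(\<lambda>x. distr T N (f x)) \<in> Q \<rightarrow>\<^sub>M prob_algebra N"
    by (rule measurable_distr_prob_space2[where M = T])
       (use T in \<open>auto simp: space_prob_algebra\<close>)
  note K' = measurable_prob_algebraD[OF K]
  show ?thesis
  proof (rule measure_eqI)
    show s: "sets (Q \<bind> (\<lambda>x. distr T N (f x))) = sets (distr (Q \<Otimes>\<^sub>M T) N (\<lambda>(x, z). f x z))"
      using sets_bind_measurable[OF K' Q.not_empty] by simp
    fix X assume "X \<in> sets (Q \<bind> (\<lambda>x. distr T N (f x)))"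
    then have [measurable]: "X \<in> sets N" using s by simp
    have "emeasure (Q \<bind> (\<lambda>x. distr T N (f x))) X = (\<integral>\<^sup>+x. emeasure (distr T N (f x)) X \<partial>Q)"
      by (rule emeasure_bind[OF Q.not_empty K']) simp
    also have "\<dots> = (\<integral>\<^sup>+x. emeasure T (Pair x -` ((\<lambda>(x, z). f x z) -` X \<inter> space (Q \<Otimes>\<^sub>M T))) \<partial>Q)"
      by (intro nn_integral_cong, subst emeasure_distr)
         (auto simp: space_pair_measure intro!: arg_cong[where f = "emeasure T"])
    also have "\<dots> = emeasure (Q \<Otimes>\<^sub>M T) ((\<lambda>(x, z). f x z) -` X \<inter> space (Q \<Otimes>\<^sub>M T))"
      by (rule T.emeasure_pair_measure_alt[symmetric]) simp
    also have "\<dots> = emeasure (distr (Q \<Otimes>\<^sub>M T) N (\<lambda>(x, z). f x z)) X"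
      by (subst emeasure_distr) auto
    finally show "emeasure (Q \<bind> (\<lambda>x. distr T N (f x))) X
      = emeasure (distr (Q \<Otimes>\<^sub>M T) N (\<lambda>(x, z). f x z)) X" .
  qed
qed

text \<open>
  The cross term \<open>2 (A x - m) s z\<close> of the square integrates to \<open>0\<close> over the centred noise \<open>z\<close>.
  The square is treated first: being nonnegative, it is integrable as soon as its iterated integral
  is, and on a probability space the first moment then exists as well.
\<close>
lemma additive_noise_moments:
  fixes A :: "'a \<Rightarrow> real" and s m :: real
  assumes Q: "prob_space Q" and [measurable]: "A \<in> borel_measurable Q"
    and sq: "integrable Q (\<lambda>x. (A x - m)\<^sup>2)" and mean: "(\<integral>x. A x \<partial>Q) = m"
  defines "L \<equiv> Q \<bind> (\<lambda>x. distr noise borel (\<lambda>z. A x + s * z))"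
  shows "integrable L (\<lambda>y. y)"
    and "(\<integral>y. y \<partial>L) = m"
    and "integrable L (\<lambda>y. (y - m)\<^sup>2)"
    and "(\<integral>y. (y - m)\<^sup>2 \<partial>L) = (\<integral>x. (A x - m)\<^sup>2 \<partial>Q) + s\<^sup>2"
proof -
  interpret Q: prob_space Q by (rule Q)
  interpret T: prob_space noise by (rule prob_space_noise)
  interpret pair_prob_space Q noise ..
  let ?p = "\<lambda>(x, z). A x + s * z"
  have L: "L = distr (Q \<Otimes>\<^sub>M noise) borel ?p"
    unfolding L_def by (rule bind_distr_eq_distr_pair[OF Q prob_space_noise]) simp
  interpret L: prob_space L
    unfolding L by (rule prob_space_distr) simp
  have inner: "integrable noise (\<lambda>z. (A x + s * z - m)\<^sup>2)"
    "(\<integral>z. (A x + s * z - m)\<^sup>2 \<partial>noise) = (A x - m)\<^sup>2 + s\<^sup>2" for x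
  proof -
    have e: "(A x + s * z - m)\<^sup>2 = (A x - m)\<^sup>2 + 2 * (A x - m) * s * z + s\<^sup>2 * z\<^sup>2" for z
      by (simp add: power2_eq_square algebra_simps)
    show "integrable noise (\<lambda>z. (A x + s * z - m)\<^sup>2)"
      unfolding e by (intro Bochner_Integration.integrable_add integrable_mult_right
          noise_integrable noise_integrable_square) simp
    show "(\<integral>z. (A x + s * z - m)\<^sup>2 \<partial>noise) = (A x - m)\<^sup>2 + s\<^sup>2"
      unfolding e using noise_integrable noise_integrable_square T.prob_space
      by (simp add: noise_mean noise_variance)
  qed
  have sq_int: "integrable (Q \<Otimes>\<^sub>M noise) (\<lambda>(x, z). (A x + s * z - m)\<^sup>2)"
    by (rule Fubini_integrable) (use inner sq in auto)
  have [simp]: "((case p of (x, z) \<Rightarrow> A x + s * z) - m)\<^sup>2 = (case p of (x, z) \<Rightarrow> (A x + s * z - m)\<^sup>2)" for p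
    by (cases p) simp
  show Lsq: "integrable L (\<lambda>y. (y - m)\<^sup>2)"
    unfolding L by (subst integrable_distr_eq) (use sq_int in simp_all)
  show "(\<integral>y. (y - m)\<^sup>2 \<partial>L) = (\<integral>x. (A x - m)\<^sup>2 \<partial>Q) + s\<^sup>2"
    unfolding L using integral_fst'[OF sq_int] sq Q.prob_space
    by (subst integral_distr) (simp_all add: inner)
  have "integrable L (\<lambda>y. y - m)"
    by (rule L.square_integrable_imp_integrable[OF _ Lsq]) (simp add: L)
  then have "integrable L (\<lambda>y. (y - m) + m)"
    by (rule Bochner_Integration.integrable_add) simp
  then show Lint: "integrable L (\<lambda>y. y)" by simp
  then have "integrable (Q \<Otimes>\<^sub>M noise) ?p"
    unfolding L by (subst (asm) integrable_distr_eq) auto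
  note integral_fst'[OF this]
  moreover have "(\<integral>z. A x + s * z \<partial>noise) = A x" for x
    using noise_integrable T.prob_space by (simp add: noise_mean)
  ultimately show "(\<integral>y. y \<partial>L) = m"
    unfolding L by (subst integral_distr) (simp_all add: mean)
qed

text \<open>
  The square of the sum expands into the products \<open>f (x i) * f (x j)\<close>, and those with
  \<open>i \<noteq> j\<close> have expectation \<open>0\<close> by independence.
\<close>
lemma iid_sum_square:
  fixes f :: "'a \<Rightarrow> real" and n :: nat
  assumes P: "prob_space P" and f: "f \<in> borel_measurable P"
    and sq: "integrable P (\<lambda>x. (f x)\<^sup>2)" and zero: "(\<integral>x. f x \<partial>P) = 0"
  defines "Q \<equiv> \<Pi>\<^sub>M i\<in>{..<n}. P"
  shows "integrable Q (\<lambda>x. (\<Sum>i<n. f (x i))\<^sup>2)"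
    and "(\<integral>x. (\<Sum>i<n. f (x i))\<^sup>2 \<partial>Q) = n * (\<integral>x. (f x)\<^sup>2 \<partial>P)"
    and "integrable Q (\<lambda>x. \<Sum>i<n. f (x i))"
    and "(\<integral>x. (\<Sum>i<n. f (x i)) \<partial>Q) = 0"
proof -
  interpret single: prob_space P by (rule P)
  interpret product_prob_space "\<lambda>_. P" "{..<n}" ..
  have fi: "integrable P f" by (rule single.square_integrable_imp_integrable[OF f sq])
  have comp: "distr Q P (\<lambda>x. x i) = P" if "i < n" for i
    unfolding Q_def by (rule PiM_component) (use that in auto)
  have meas: "(\<lambda>x. x i) \<in> Q \<rightarrow>\<^sub>M P" if "i < n" for i
    unfolding Q_def by (rule measurable_component_singleton) (use that in auto)
  have one: "integrable Q (\<lambda>x. f (x i))" "(\<integral>x. f (x i) \<partial>Q) = 0" if "i < n" for i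
    using integrable_distr_eq[OF meas[OF that] f] integral_distr[OF meas[OF that] f] fi zero
    by (simp_all add: comp[OF that])
  show "integrable Q (\<lambda>x. \<Sum>i<n. f (x i))" "(\<integral>x. (\<Sum>i<n. f (x i)) \<partial>Q) = 0"
    using one by (auto intro!: Bochner_Integration.integrable_sum simp: Bochner_Integration.integral_sum)
  have two: "integrable Q (\<lambda>x. f (x i) * f (x j))"
    "(\<integral>x. f (x i) * f (x j) \<partial>Q) = (if i = j then (\<integral>x. (f x)\<^sup>2 \<partial>P) else 0)"
    if ij: "i < n" "j < n" for i j
  proof -
    \<comment> \<open>The product of two coordinates is written as a product over all coordinates, with factor
      \<open>1\<close> elsewhere, so that the integral over the product measure factorises.\<close>
    let ?g = "\<lambda>k y. (if k = i then f y else 1) * (if k = j then f y else 1)"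
    have gi: "integrable P (?g k)" for k
      using fi sq by (cases "k = i"; cases "k = j") (auto simp: power2_eq_square)
    have pr: "(\<Prod>k<n. ?g k (x k)) = f (x i) * f (x j)" for x
      using ij by (simp add: prod.distrib)
    show "integrable Q (\<lambda>x. f (x i) * f (x j))"
      using product_integrable_prod[of "{..<n}" ?g] gi by (simp add: pr Q_def)
    have "(\<integral>x. f (x i) * f (x j) \<partial>Q) = (\<Prod>k<n. \<integral>y. ?g k y \<partial>P)"
      using product_integral_prod[of "{..<n}" ?g] gi by (simp add: pr Q_def)
    also have "\<dots> = (if i = j then (\<integral>x. (f x)\<^sup>2 \<partial>P) else 0)"
    proof (cases "i = j")
      case True
      have "(\<integral>y. ?g k y \<partial>P) = (if k = i then (\<integral>x. (f x)\<^sup>2 \<partial>P) else 1)" for k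
        using True single.prob_space by (simp add: power2_eq_square)
      then show ?thesis using True ij by simp
    next
      case False
      have "(\<integral>y. ?g i y \<partial>P) = 0" using False zero by simp
      then show ?thesis using False ij by (auto intro!: prod_zero bexI[of _ i])
    qed
    finally show "(\<integral>x. f (x i) * f (x j) \<partial>Q) = (if i = j then (\<integral>x. (f x)\<^sup>2 \<partial>P) else 0)" .
  qed
  have sum_sq: "(\<Sum>i<n. f (x i))\<^sup>2 = (\<Sum>i<n. \<Sum>j<n. f (x i) * f (x j))" for x
    by (simp add: power2_eq_square sum_product)
  show "integrable Q (\<lambda>x. (\<Sum>i<n. f (x i))\<^sup>2)"
    unfolding sum_sq by (intro Bochner_Integration.integrable_sum two) auto
  have "(\<integral>x. (\<Sum>i<n. f (x i))\<^sup>2 \<partial>Q) = (\<Sum>i<n. \<Sum>j<n. \<integral>x. f (x i) * f (x j) \<partial>Q)"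
    unfolding sum_sq
    by (subst Bochner_Integration.integral_sum; (intro Bochner_Integration.integrable_sum two)?)
       (auto intro!: sum.cong Bochner_Integration.integral_sum two)
  also have "\<dots> = n * (\<integral>x. (f x)\<^sup>2 \<partial>P)"
    by (simp add: two)
  finally show "(\<integral>x. (\<Sum>i<n. f (x i))\<^sup>2 \<partial>Q) = n * (\<integral>x. (f x)\<^sup>2 \<partial>P)" .
qed

section \<open>Sensitivity of the empirical mean\<close>

text \<open>
  The empty dataset has average \<open>0\<close>, because division by zero yields zero; the privacy bound
  needs this value to lie in \<open>[a,b]\<close>.
\<close>
definition average :: "real list \<Rightarrow> real" where
  "average xs = sum_list xs / real (length xs)"

lemma average_map_upt: "average (map x [0..<n]) = (\<Sum>i<n. x i) / real n"
  by (simp add: average_def interv_sum_list_conv_sum_set_nat atLeast0LessThan)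

lemma sum_list_in_lists_bounds:
  fixes a b :: real
  assumes "xs \<in> lists {a..b}"
  shows "real (length xs) * a \<le> sum_list xs" "sum_list xs \<le> real (length xs) * b"
  using assms by (induction xs) (auto simp: algebra_simps)

text \<open>
  Inserting \<open>z\<close> into a dataset of size \<open>n\<close> moves the average by \<open>1 / (n + 1)\<close> times its distance
  from \<open>z\<close>, and both lie in \<open>[a,b]\<close>. For \<open>n = 0\<close> this is where \<open>a \<le> 0 \<le> b\<close> enters.
\<close>
lemma average_insert:
  fixes a b z :: real
  assumes "a \<le> 0" "0 \<le> b" "xs \<in> lists {a..b}" "ys \<in> lists {a..b}" "z \<in> {a..b}"
  shows "\<bar>average (xs @ ys) - average (xs @ [z] @ ys)\<bar> \<le> (b - a) / (real (length xs + length ys) + 1)"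
proof -
  define n where "n = real (length xs + length ys)"
  define S where "S = sum_list (xs @ ys)"
  have n0: "n \<ge> 0" by (simp add: n_def)
  have S: "n * a \<le> S" "S \<le> n * b"
    using sum_list_in_lists_bounds[of "xs @ ys" a b] assms by (simp_all add: n_def S_def)
  have A: "a \<le> S / n" "S / n \<le> b"
    using S n0 assms by (cases "n = 0"; simp add: field_simps)+
  have "S / n - (S + z) / (n + 1) = (S / n - z) / (n + 1)"
  proof (cases "n = 0")
    case True
    then have "S = 0" using S by simp
    then show ?thesis using True by simp
  next
    case False
    then show ?thesis using n0 by (simp add: field_simps)
  qed
  then have "average (xs @ ys) - average (xs @ [z] @ ys) = (S / n - z) / (n + 1)"
    by (simp add: average_def n_def S_def add_ac)
  moreover have "\<bar>S / n - z\<bar> \<le> b - a" using A assms by auto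
  ultimately show ?thesis
    using n0 by (simp add: n_def abs_divide divide_right_mono)
qed

lemma average_replace:
  fixes a b :: real
  assumes "y \<in> {a..b}" "z \<in> {a..b}"
  shows "\<bar>average (xs @ [y] @ ys) - average (xs @ [z] @ ys)\<bar> \<le> (b - a) / (real (length xs + length ys) + 1)"
proof -
  have "average (xs @ [y] @ ys) - average (xs @ [z] @ ys) = (y - z) / (real (length xs + length ys) + 1)"
    by (simp add: average_def add_ac flip: diff_divide_distrib)
  moreover have "\<bar>y - z\<bar> \<le> b - a" using assms by auto
  ultimately show ?thesis
    by (simp add: abs_divide divide_right_mono)
qed

lemma average_sensitivity:
  fixes a b :: real
  assumes "neighbouring x x'" "a \<le> 0" "0 \<le> b" "x \<in> lists {a..b}" "x' \<in> lists {a..b}"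
  shows "\<bar>average x - average x'\<bar> \<le> (b - a) / max 1 (real (length x))"
  using assms
proof cases
  case (add xs ys z)
  have "\<bar>average x - average x'\<bar> \<le> (b - a) / (real (length xs + length ys) + 1)"
    using average_insert[of a b xs ys z] assms add by auto
  also have "\<dots> \<le> (b - a) / max 1 (real (length x))"
    using assms add by (intro divide_left_mono) auto
  finally show ?thesis .
next
  case (remove xs z ys)
  then show ?thesis
    using average_insert[of a b xs ys z] assms by (auto simp: abs_minus_commute add_ac max_def)
next
  case (replace xs y ys z)
  then show ?thesis
    using average_replace[of y a b z xs ys] assms by (auto simp: add_ac max_def)
qed

section \<open>A noise scale that varies slowly with the size of the dataset\<close>

text \<open>
  At \<open>n = 0\<close> the second argument of the maximum is \<open>0\<close>, so the value is \<open>exp t\<close>.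
\<close>
definition smooth_scale :: "real \<Rightarrow> nat \<Rightarrow> real" where
  "smooth_scale t n = max (exp (- t * (real n - 1))) (1 / real n)"

lemma smooth_scale_pos: "smooth_scale t n > 0"
  by (simp add: smooth_scale_def less_max_iff_disj)

lemma smooth_scale_lower:
  assumes "t \<ge> 0"
  shows "1 / max 1 (real n) \<le> smooth_scale t n"
  using assms by (cases n) (auto simp: smooth_scale_def le_max_iff_disj)

lemma smooth_scale_Suc_le:
  assumes "t \<ge> 0"
  shows "smooth_scale t (Suc n) \<le> smooth_scale t n"
proof (cases "n = 0")
  case True
  then show ?thesis using assms by (simp add: smooth_scale_def)
next
  case False
  then show ?thesis
    using assms unfolding smooth_scale_def
    by (intro max.mono) (auto simp: field_simps)
qed

text \<open>
  The exponential branch shrinks by exactly \<open>exp t\<close>. When \<open>1/n\<close> is the larger branch, taking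
  logarithms gives \<open>ln n \<le> t (n - 1)\<close>, and \<open>ln n \<ge> 1 - 1/n = (n - 1) / n\<close> turns this into
  \<open>1/n \<le> t\<close>, whence \<open>(n + 1) / n \<le> exp t\<close>.
\<close>
lemma smooth_scale_le_Suc:
  assumes "t \<ge> 0"
  shows "smooth_scale t n \<le> exp t * smooth_scale t (Suc n)"
proof -
  have e: "exp (- t * (real n - 1)) = exp t * exp (- t * real n)"
    by (simp add: algebra_simps flip: exp_add)
  have "1 / real n \<le> exp t * smooth_scale t (Suc n)"
    if n: "n > 0" and dom: "exp (- t * (real n - 1)) \<le> 1 / real n"
  proof -
    have "ln (real n) \<le> t * (real n - 1)"
    proof -
      have "ln (exp (- t * (real n - 1))) \<le> ln (1 / real n)"
        using dom n by (subst ln_le_cancel_iff) auto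
      then show ?thesis using n by (simp add: ln_div)
    qed
    moreover have "1 - 1 / real n \<le> ln (real n)"
      using ln_le_minus_one[of "1 / real n"] n by (simp add: ln_div)
    ultimately have le: "1 - 1 / real n \<le> t * (real n - 1)" by simp
    show ?thesis
    proof (cases "n = 1")
      \<comment> \<open>Both branches equal \<open>1\<close> here and the logarithmic estimate is void, but the exponential
        branch of the successor suffices.\<close>
      case True
      have "1 \<le> exp t * exp (- t)" by (simp flip: exp_add)
      also have "\<dots> \<le> exp t * smooth_scale t (Suc n)"
        using True by (intro mult_left_mono) (auto simp: smooth_scale_def)
      finally show ?thesis using True by simp
    next
      case False
      then have n1: "real n > 1" using n by simp
      then have "(real n - 1) * (1 / real n) \<le> (real n - 1) * t"
        using le by (simp add: field_simps)
      then have "1 / real n \<le> t"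
        using n1 by (subst (asm) mult_le_cancel_left_pos) auto
      then have "1 + 1 / real n \<le> exp t"
        using exp_ge_add_one_self[of t] by linarith
      then have "1 / real n \<le> exp t * (1 / real (Suc n))"
        using n by (simp add: field_simps)
      also have "\<dots> \<le> exp t * smooth_scale t (Suc n)"
        by (intro mult_left_mono) (auto simp: smooth_scale_def)
      finally show ?thesis .
    qed
  qed
  moreover have "exp (- t * (real n - 1)) \<le> exp t * smooth_scale t (Suc n)"
    unfolding e by (intro mult_left_mono) (auto simp: smooth_scale_def)
  ultimately show ?thesis
    unfolding smooth_scale_def[of t n] by (cases "n = 0") (auto simp: max_def)
qed

lemma smooth_scale_square:
  "(smooth_scale t n)\<^sup>2 = max (exp (- (2 * t) * (real n - 1))) (1 / (real n)\<^sup>2)"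
proof -
  have "(max u v)\<^sup>2 = max (u\<^sup>2) (v\<^sup>2)" if "u \<ge> 0" "v \<ge> 0" for u v :: real
    using that by (auto simp: max_def intro: power_mono antisym dest: power2_le_imp_le)
  then show ?thesis
    by (simp add: smooth_scale_def power_divide mult.assoc flip: exp_double)
qed

lemma smooth_scale_neighbouring:
  assumes "neighbouring x x'" "t \<ge> 0"
  shows "smooth_scale t (length x) \<le> exp t * smooth_scale t (length x')"
proof -
  have grow: "smooth_scale t k \<le> exp t * smooth_scale t k" for k
    using assms(2) smooth_scale_pos[of t k] by simp
  from assms(1) show ?thesis
  proof cases
    case (add xs ys z)
    then show ?thesis using smooth_scale_le_Suc[OF assms(2), of "length x"] by simp
  next
    case (remove xs z ys)
    then show ?thesis
      using smooth_scale_Suc_le[OF assms(2), of "length x'"] grow[of "length x'"] by simp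
  next
    case (replace xs y ys z)
    then show ?thesis using grow by simp
  qed
qed

lemma neighbouring_sym: "neighbouring x x' \<Longrightarrow> neighbouring x' x"
  by (induction rule: neighbouring.induct) (rule neighbouring.intros)+

section \<open>The mechanism\<close>

text \<open>
  The factor \<open>3 / \<epsilon>\<close> makes a shift by \<open>\<epsilon>/3\<close> times the noise scale the largest possible one,
  hence costs \<open>2\<epsilon>/3\<close>; the rate \<open>\<epsilon>/12\<close> makes the square of the scale decay at the rate
  \<open>\<epsilon>/6\<close>, and a change of size by one then costs at most \<open>3 \<epsilon>/12 = \<epsilon>/4\<close>.
\<close>
definition private_mean :: "real \<Rightarrow> real \<Rightarrow> real \<Rightarrow> real list \<Rightarrow> real measure" where
  "private_mean \<epsilon> a b xs =
     distr noise borel (\<lambda>z. average xs + 3 * (b - a) / \<epsilon> * smooth_scale (\<epsilon> / 12) (length xs) * z)"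

lemma private_mean_randomized_algorithm: "randomized_algorithm a b (private_mean \<epsilon> a b)"
  unfolding randomized_algorithm_def private_mean_def
proof (intro allI measurable_distr_prob_space2)
  fix n :: nat
  show "(\<lambda>x. noise) \<in> (\<Pi>\<^sub>M i\<in>{..<n}. restrict_space borel {a..b}) \<rightarrow>\<^sub>M prob_algebra borel"
    by (simp add: space_prob_algebra prob_space_noise)
  have [measurable]: "(\<lambda>x. x) \<in> borel_measurable (restrict_space borel {a..b})"
    by (rule measurable_restrict_space1) simp
  have [measurable]: "(\<lambda>x. x i) \<in> borel_measurable (\<Pi>\<^sub>M i\<in>{..<n}. restrict_space borel {a..b})"
    if "i < n" for i
    by (rule measurable_compose[OF measurable_component_singleton]) (use that in auto)
  show "(\<lambda>(x, z). average (map x [0..<n])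
        + 3 * (b - a) / \<epsilon> * smooth_scale (\<epsilon> / 12) (length (map x [0..<n])) * z)
      \<in> borel_measurable ((\<Pi>\<^sub>M i\<in>{..<n}. restrict_space borel {a..b}) \<Otimes>\<^sub>M borel)"
    unfolding average_map_upt by simp
qed

lemma private_mean_private:
  assumes "\<epsilon> > 0" "a \<le> 0" "0 \<le> b"
  shows "differentially_private \<epsilon> a b (private_mean \<epsilon> a b)"
  unfolding differentially_private_def
proof (intro ballI impI)
  fix x x' :: "real list" and S :: "real set"
  assume x: "x \<in> lists {a..b}" "x' \<in> lists {a..b}" "neighbouring x x'" and S: "S \<in> sets borel"
  define t where "t = \<epsilon> / 12"
  define c where "c = 3 * (b - a) / \<epsilon>"
  define s where "s = c * smooth_scale t (length x)"
  define s' where "s' = c * smooth_scale t (length x')"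
  have t: "t \<ge> 0" using assms by (simp add: t_def)
  have c0: "c \<ge> 0" using assms by (simp add: c_def)
  show "measure (private_mean \<epsilon> a b x) S \<le> exp \<epsilon> * measure (private_mean \<epsilon> a b x') S"
  proof (cases "a = b")
    \<comment> \<open>Then \<open>a = b = 0\<close>, the noise scale is \<open>0\<close>, and every dataset gives the point mass at \<open>0\<close>,
      which has no density.\<close>
    case True
    then have "average y = 0" if "y \<in> lists {a..b}" for y
      using sum_list_in_lists_bounds[OF that] assms by (simp add: average_def)
    then have "private_mean \<epsilon> a b x = private_mean \<epsilon> a b x'"
      using x True by (simp add: private_mean_def)
    then show ?thesis
      using assms mult_right_mono[of 1 "exp \<epsilon>" "measure (private_mean \<epsilon> a b x') S"] by simp
  next
    case False
    then have c: "c > 0" using assms by (simp add: c_def)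
    have s: "s > 0" "s' > 0" using c by (simp_all add: s_def s'_def smooth_scale_pos)
    have ss: "s \<le> exp t * s'" "s' \<le> exp t * s"
      using mult_left_mono[OF smooth_scale_neighbouring[OF x(3) t] c0]
        mult_left_mono[OF smooth_scale_neighbouring[OF neighbouring_sym[OF x(3)] t] c0]
      by (simp_all add: s_def s'_def mult_ac)
    have "\<bar>average x - average x'\<bar> \<le> (b - a) * (1 / max 1 (real (length x)))"
      using average_sensitivity[OF x(3)] x assms by simp
    also have "\<dots> \<le> (b - a) * smooth_scale t (length x)"
      using assms by (intro mult_left_mono smooth_scale_lower t) auto
    also have "\<dots> = \<epsilon> / 3 * s"
      using assms by (simp add: s_def c_def)
    finally have "2 * \<bar>average x - average x'\<bar> / s \<le> 2 * \<epsilon> / 3"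
      using s by (simp add: field_simps)
    then have "2 * \<bar>average x - average x'\<bar> / s + 3 * t \<le> \<epsilon>"
      using assms by (simp add: t_def)
    then have "exp (2 * \<bar>average x - average x'\<bar> / s) * exp t ^ 3 \<le> exp \<epsilon>"
      by (simp flip: exp_add exp_of_nat_mult)
    from affine_noise_private[OF s _ ss this S] t show ?thesis
      by (simp add: private_mean_def s_def s'_def c_def t_def)
  qed
qed

lemma private_mean_moments:
  fixes P :: "real measure" and \<epsilon> :: real
  assumes "a \<le> 0" "0 \<le> b" and P: "distribution_supported_on P {a..b}" and n: "n \<ge> 1"
  defines "L \<equiv> output_law a b (private_mean \<epsilon> a b) P n"
  shows "integrable L (\<lambda>y. y)"
    and "(\<integral>y. y \<partial>L) = mean P"
    and "integrable L (\<lambda>y. (y - mean P)\<^sup>2)"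
    and "(\<integral>y. (y - mean P)\<^sup>2 \<partial>L)
      = (\<integral>x. (x - mean P)\<^sup>2 \<partial>P) / n + (3 * (b - a) / \<epsilon> * smooth_scale (\<epsilon> / 12) n)\<^sup>2"
proof -
  have prob: "prob_space P" and sets [measurable_cong]: "sets P = sets borel"
    and one: "measure P {a..b} = 1"
    using P by (auto simp: distribution_supported_on_def)
  interpret P: prob_space P by (rule prob)
  define R where "R = restrict_space P {a..b}"
  have R: "prob_space R"
    unfolding R_def
    by (rule prob_space_restrict_space) (use one in \<open>auto simp: sets P.emeasure_eq_measure\<close>)
  interpret R: prob_space R by (rule R)
  have supp: "AE x in P. x \<in> {a..b}"
    using one by (intro P.AE_prob_1) auto
  have integral_R: "(\<integral>x. g x \<partial>R) = (\<integral>x. g x \<partial>P)" if [measurable]: "g \<in> borel_measurable borel"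
    for g :: "real \<Rightarrow> real"
    unfolding R_def using supp
    by (subst integral_restrict_space) (auto simp: sets intro!: integral_cong_AE)
  have spaceR: "x \<in> {a..b}" if "x \<in> space R" for x
    using that by (auto simp: R_def space_restrict_space)
  have id_R [measurable]: "(\<lambda>x. x) \<in> borel_measurable R"
    unfolding R_def by (rule measurable_restrict_space1) simp
  have int_R: "integrable R (\<lambda>x. x)"
    by (rule R.integrable_const_bound[where B = "max \<bar>a\<bar> \<bar>b\<bar>"]) (auto intro!: AE_I2 dest!: spaceR)
  define \<mu> where "\<mu> = mean P"
  have mean_R: "(\<integral>x. x - \<mu> \<partial>R) = 0"
  proof -
    have "(\<integral>x. x \<partial>R) = \<mu>"
      unfolding \<mu>_def mean_def by (rule integral_R) simp
    with int_R R.prob_space show ?thesis by simp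
  qed
  have sq_R: "integrable R (\<lambda>x. (x - \<mu>)\<^sup>2)"
  proof (rule R.integrable_const_bound[where B = "(\<bar>a\<bar> + \<bar>b\<bar> + \<bar>\<mu>\<bar>)\<^sup>2"])
    show "AE x in R. norm ((x - \<mu>)\<^sup>2) \<le> (\<bar>a\<bar> + \<bar>b\<bar> + \<bar>\<mu>\<bar>)\<^sup>2"
    proof (rule AE_I2)
      fix x assume "x \<in> space R"
      then have "\<bar>x - \<mu>\<bar> \<le> \<bar>a\<bar> + \<bar>b\<bar> + \<bar>\<mu>\<bar>" by (auto dest!: spaceR)
      from power_mono[OF this, of 2] show "norm ((x - \<mu>)\<^sup>2) \<le> (\<bar>a\<bar> + \<bar>b\<bar> + \<bar>\<mu>\<bar>)\<^sup>2"
        by simp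
    qed
  qed simp
  define Q where "Q = (\<Pi>\<^sub>M i\<in>{..<n}. R)"
  have Q: "prob_space Q"
    unfolding Q_def by (rule prob_space_PiM) (rule R)
  interpret Q: prob_space Q by (rule Q)
  note iid = iid_sum_square[OF R _ sq_R mean_R, of n, folded Q_def]
  define A where "A x = (\<Sum>i<n. x i) / real n" for x :: "nat \<Rightarrow> real"
  have dev: "A x - \<mu> = (\<Sum>i<n. x i - \<mu>) / real n" for x
    using n by (simp add: A_def sum_subtractf diff_divide_distrib)
  have [measurable]: "(\<lambda>x. x i) \<in> borel_measurable Q" if "i < n" for i
    unfolding Q_def
    by (rule measurable_compose[OF measurable_component_singleton]) (use that in auto)
  have A [measurable]: "A \<in> borel_measurable Q"
    unfolding A_def by simp
  have A_sq: "integrable Q (\<lambda>x. (A x - \<mu>)\<^sup>2)"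
    unfolding dev using iid(1) by (simp add: power_divide)
  have "integrable Q (\<lambda>x. A x - \<mu>)" "(\<integral>x. A x - \<mu> \<partial>Q) = 0"
    unfolding dev using iid(3,4) by simp_all
  then have A_mean: "(\<integral>x. A x \<partial>Q) = \<mu>"
    using Q.prob_space Bochner_Integration.integral_add[of Q "\<lambda>x. A x - \<mu>" "\<lambda>_. \<mu>"] by simp
  have A_var: "(\<integral>x. (A x - \<mu>)\<^sup>2 \<partial>Q) = (\<integral>x. (x - \<mu>)\<^sup>2 \<partial>P) / n"
    unfolding dev using iid(2) n integral_R[of "\<lambda>x. (x - \<mu>)\<^sup>2"]
    by (simp add: power_divide) (simp add: power2_eq_square)
  let ?s = "3 * (b - a) / \<epsilon> * smooth_scale (\<epsilon> / 12) n"
  have L: "L = Q \<bind> (\<lambda>x. distr noise borel (\<lambda>z. A x + ?s * z))"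
    by (simp add: L_def output_law_def private_mean_def average_map_upt A_def Q_def R_def)
  note M = additive_noise_moments[OF Q A A_sq A_mean, of ?s, folded L]
  show "integrable L (\<lambda>y. y)" "(\<integral>y. y \<partial>L) = mean P" "integrable L (\<lambda>y. (y - mean P)\<^sup>2)"
    "(\<integral>y. (y - mean P)\<^sup>2 \<partial>L) = (\<integral>x. (x - mean P)\<^sup>2 \<partial>P) / n + ?s\<^sup>2"
    using M A_var by (simp_all add: \<mu>_def)
qed

theorem theoremE6:
  fixes \<epsilon> a b :: real
  assumes "\<epsilon> > 0" and "a \<le> 0" and "0 \<le> b"
  shows "\<exists>M :: real list \<Rightarrow> real measure.
    randomized_algorithm a b M \<and> differentially_private \<epsilon> a b M \<and>
    (\<forall>P :: real measure.
       distribution_supported_on P {a..b} \<and> (\<integral>x. (x - mean P)\<^sup>2 \<partial>P) \<le> 1 \<longrightarrow>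
       (\<forall>n::nat. n \<ge> 1 \<longrightarrow>
          integrable (output_law a b M P n) (\<lambda>y. y) \<and>
          (\<integral>y. y \<partial>output_law a b M P n) = mean P \<and>
          integrable (output_law a b M P n) (\<lambda>y. (y - mean P)\<^sup>2) \<and>
          (\<integral>y. (y - mean P)\<^sup>2 \<partial>output_law a b M P n)
            \<le> 1 / real n + 9 / \<epsilon>\<^sup>2 * (b - a)\<^sup>2 *
                max (exp (- \<epsilon> * (real n - 1) / 6)) (1 / (real n)\<^sup>2)))"
proof (intro exI[of _ "private_mean \<epsilon> a b"] conjI allI impI)
  show "randomized_algorithm a b (private_mean \<epsilon> a b)"
    by (rule private_mean_randomized_algorithm)
  show "differentially_private \<epsilon> a b (private_mean \<epsilon> a b)"
    by (rule private_mean_private[OF assms])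
  fix P :: "real measure" and n :: nat
  assume P: "distribution_supported_on P {a..b} \<and> (\<integral>x. (x - mean P)\<^sup>2 \<partial>P) \<le> 1" and n: "n \<ge> 1"
  let ?L = "output_law a b (private_mean \<epsilon> a b) P n"
  note M = private_mean_moments[OF assms(2,3) conjunct1[OF P] n, of \<epsilon>]
  show "integrable ?L (\<lambda>y. y)" "(\<integral>y. y \<partial>?L) = mean P" "integrable ?L (\<lambda>y. (y - mean P)\<^sup>2)"
    by (fact M)+
  have "(\<integral>x. (x - mean P)\<^sup>2 \<partial>P) / n \<le> 1 / n"
    using P by (intro divide_right_mono) auto
  moreover have "(3 * (b - a))\<^sup>2 = 9 * (b - a)\<^sup>2"
    by (simp add: power2_eq_square algebra_simps)
  then have "(3 * (b - a) / \<epsilon> * smooth_scale (\<epsilon> / 12) n)\<^sup>2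
      = 9 / \<epsilon>\<^sup>2 * (b - a)\<^sup>2 * max (exp (- \<epsilon> * (real n - 1) / 6)) (1 / (real n)\<^sup>2)"
    unfolding power_mult_distrib[of "_ / _"] power_divide smooth_scale_square by simp
  ultimately show "(\<integral>y. (y - mean P)\<^sup>2 \<partial>?L)
      \<le> 1 / real n + 9 / \<epsilon>\<^sup>2 * (b - a)\<^sup>2 * max (exp (- \<epsilon> * (real n - 1) / 6)) (1 / (real n)\<^sup>2)"
    by (simp add: M)
qed

end
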